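(* Let $C$ be a finite set of constants, $f$ an AC symbol, $S=S_C\cup S_f$ a finite set of ground equations where $S_C$ consists of equations between constants and $S_f$ of equations between $f$-monomials over $C$, and $\gg_f$ a total admissible ordering on $f$-monomials extending a total ordering on $C$. Then the rewrite system $R_f$ output by SingleACCompletion$(S,\gg_f)$ is canonical (terminating and confluent) and decides $ACCC(S)$: for all $f$-monomials $s,t$, $s=t\in ACCC(S)$ if and only if $s$ and $t$ have the same normal form with respect to $R_f$.
   Context: $f$-monomials: $f(M)$ with $M$ a nonempty finite multiset over $C$; a constant $c$ is identified with $f(\{\!\{c\}\!\})$. On multisets $\cup$ is multiset sum, $\cap$ multiset intersection (min of multiplicities), $-$ truncated multiset difference, $\subseteq$ sub-multiset. A rule $f(A)\rightarrow f(B)$ rewrites $f(M)$ to $f((M-A)\cup B)$ when $A\subseteq M$. Admissible ordering: a total well-founded ordering $\gg_f$ on $f$-monomials extending a total ordering $\gg$ on $C$ with $f(A)\gg_f f(B)$ whenever $B$ is a proper sub-multiset of $A$, and $f(A_1)\gg_f f(A_2)\Rightarrow f(A_1\cup B)\gg_f f(A_2\cup B)$. $ACCC(S)$ is the smallest equivalence relation on $f$-monomials containing $S$ and such that $f(M_1)=f(M_2)$ and $f(N_1)=f(N_2)$ in it imply $f(M_1\cup N_1)=f(M_2\cup N_2)$ in it. Critical pair of distinct rules $f(A_1)\rightarrow f(A_2)$, $f(B_1)\rightarrow f(B_2)$: $(f((AB-A_1)\cup A_2), f((AB-B_1)\cup B_2))$ with $AB=(A_1\cup B_1)-(A_1\cap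 B_1)$. Algorithm SingleACCompletion$(S_f\cup S_C,\gg_f)$: (1) For each constant $c$ let $\hat c$ be the $\gg$-least constant in its equivalence class generated by $S_C$; $R_C=\{c\rightarrow\hat c\mid c\ne\hat c\}$; $R_f:=R_C$, $T:=S_f$. (2) Pick and remove $l=r$ from $T$; compute normal forms $\hat l,\hat r$ w.r.t. $R_f$; if equal discard, else orient with $\gg_f$ into $\hat l\rightarrow\hat r$ ($\hat l\gg_f\hat r$). (3) Add to $T$ the critical pairs between $\hat l\rightarrow\hat r$ and every rule of $R_f$. (4) Add $\hat l\rightarrow\hat r$ to $R_f$; for each other rule $l\rightarrow r$ of $R_f$: if $l$ is reducible by the new rule, move $l=r$ to $T$; else if $r$ is reducible, replace $r$ by a normal form of its reduct. (5) Repeat (2)–(4) until $T$ is empty and all critical pairs among rules of $R_f$ are joinable. (6) Output $R_f$. *)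

theory Defs
  imports "HOL-Library.Multiset" "HOL-Library.Confluence"
begin

text \<open>The monomial \<open>f(M)\<close> is represented by the multiset \<open>M\<close>, and a constant \<open>c\<close> by \<open>{#c#}\<close>;
  this is equality modulo associativity and commutativity of \<open>f\<close>. Equations and rules are
  pairs of monomials. The sum of multisets is \<open>+\<close>.\<close>

type_synonym 'c monomial = "'c multiset"
type_synonym 'c eqs = "('c monomial \<times> 'c monomial) set"

definition monomials :: "'c set \<Rightarrow> 'c monomial set" where
  "monomials C = {M. M \<noteq> {#} \<and> set_mset M \<subseteq> C}"

definition const_eqs :: "('c \<times> 'c) set \<Rightarrow> 'c eqs" where
  "const_eqs SC = {({#c#}, {#d#}) | c d. (c, d) \<in> SC}"

definition strict_total_order_on :: "'a set \<Rightarrow> ('a \<Rightarrow> 'a \<Rightarrow> bool) \<Rightarrow> bool" where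
  "strict_total_order_on A gt \<longleftrightarrow> irreflp_on A gt \<and> transp_on A gt \<and> totalp_on A gt"

text \<open>\<open>gt x y\<close> reads ``\<open>x\<close> is greater than \<open>y\<close>'', hence the converse in the
  well-foundedness condition.\<close>

definition admissible_ordering ::
  "'c set \<Rightarrow> ('c \<Rightarrow> 'c \<Rightarrow> bool) \<Rightarrow> ('c monomial \<Rightarrow> 'c monomial \<Rightarrow> bool) \<Rightarrow> bool" where
  "admissible_ordering C gt gtf \<longleftrightarrow>
     strict_total_order_on (monomials C) gtf \<and>
     wfp_on (monomials C) gtf\<inverse>\<inverse> \<and>
     (\<forall>c\<in>C. \<forall>d\<in>C. gt c d \<longrightarrow> gtf {#c#} {#d#}) \<and>
     (\<forall>A\<in>monomials C. \<forall>B\<in>monomials C. B \<subset># A \<longrightarrow> gtf A B) \<and>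
     (\<forall>A1\<in>monomials C. \<forall>A2\<in>monomials C. \<forall>B\<in>monomials C.
        gtf A1 A2 \<longrightarrow> gtf (A1 + B) (A2 + B))"

inductive_set ACCC :: "'c set \<Rightarrow> 'c eqs \<Rightarrow> 'c eqs" for C S where
  base: "(s, t) \<in> S \<Longrightarrow> (s, t) \<in> ACCC C S"
| refl: "s \<in> monomials C \<Longrightarrow> (s, s) \<in> ACCC C S"
| sym: "(s, t) \<in> ACCC C S \<Longrightarrow> (t, s) \<in> ACCC C S"
| trans: "(s, t) \<in> ACCC C S \<Longrightarrow> (t, u) \<in> ACCC C S \<Longrightarrow> (s, u) \<in> ACCC C S"
| cong: "(M1, M2) \<in> ACCC C S \<Longrightarrow> (N1, N2) \<in> ACCC C S \<Longrightarrow> (M1 + N1, M2 + N2) \<in> ACCC C S"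

inductive rstep :: "'c set \<Rightarrow> 'c eqs \<Rightarrow> 'c monomial \<Rightarrow> 'c monomial \<Rightarrow> bool" for C R where
  "(A, B) \<in> R \<Longrightarrow> M \<in> monomials C \<Longrightarrow> A \<subseteq># M \<Longrightarrow> rstep C R M ((M - A) + B)"

definition reducible :: "'c set \<Rightarrow> 'c eqs \<Rightarrow> 'c monomial \<Rightarrow> bool" where
  "reducible C R s \<longleftrightarrow> (\<exists>t. rstep C R s t)"

definition normal_form_of :: "'c set \<Rightarrow> 'c eqs \<Rightarrow> 'c monomial \<Rightarrow> 'c monomial \<Rightarrow> bool" where
  "normal_form_of C R s u \<longleftrightarrow> (rstep C R)\<^sup>*\<^sup>* s u \<and> \<not> reducible C R u"

definition joinable :: "'c set \<Rightarrow> 'c eqs \<Rightarrow> 'c monomial \<Rightarrow> 'c monomial \<Rightarrow> bool" where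
  "joinable C R s t \<longleftrightarrow> (\<exists>u. (rstep C R)\<^sup>*\<^sup>* s u \<and> (rstep C R)\<^sup>*\<^sup>* t u)"

definition canonical :: "'c set \<Rightarrow> 'c eqs \<Rightarrow> bool" where
  "canonical C R \<longleftrightarrow> wfp (rstep C R)\<inverse>\<inverse> \<and> confluentp (rstep C R)"

fun critical_pair ::
  "'c monomial \<times> 'c monomial \<Rightarrow> 'c monomial \<times> 'c monomial \<Rightarrow> 'c monomial \<times> 'c monomial" where
  "critical_pair (A1, A2) (B1, B2) =
     (let AB = (A1 + B1) - (A1 \<inter># B1) in ((AB - A1) + A2, (AB - B1) + B2))"

text \<open>The rules \<open>c \<rightarrow> d\<close> where \<open>d \<noteq> c\<close> is the least constant equivalent to \<open>c\<close>.\<close>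

definition const_rules :: "'c set \<Rightarrow> ('c \<Rightarrow> 'c \<Rightarrow> bool) \<Rightarrow> ('c \<times> 'c) set \<Rightarrow> 'c eqs" where
  "const_rules C gt SC =
     {({#c#}, {#d#}) | c d. c \<in> C \<and> c \<noteq> d \<and>
        equivclp (\<lambda>x y. (x, y) \<in> SC) c d \<and>
        (\<forall>e. equivclp (\<lambda>x y. (x, y) \<in> SC) c e \<and> e \<noteq> d \<longrightarrow> gt e d)}"

text \<open>\<open>interreduce C new P T R T' R'\<close>: treating the rules in \<open>P\<close> one after the other, in any
  order, against the rule \<open>new\<close> turns the pending equations \<open>T\<close> and the rules \<open>R\<close> into
  \<open>T'\<close> and \<open>R'\<close>.\<close>

inductive interreduce ::
  "'c set \<Rightarrow> 'c monomial \<times> 'c monomial \<Rightarrow> 'c eqs \<Rightarrow> 'c eqs \<Rightarrow> 'c eqs \<Rightarrow> 'c eqs \<Rightarrow> 'c eqs \<Rightarrow> bool"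
  for C new where
  finished: "interreduce C new {} T R T R"
| move: "(l, r) \<in> P \<Longrightarrow> reducible C {new} l \<Longrightarrow>
    interreduce C new (P - {(l, r)}) (insert (l, r) T) (R - {(l, r)}) T' R' \<Longrightarrow>
    interreduce C new P T R T' R'"
| simplify: "(l, r) \<in> P \<Longrightarrow> \<not> reducible C {new} l \<Longrightarrow>
    rstep C {new} r u \<Longrightarrow> normal_form_of C R u r' \<Longrightarrow>
    interreduce C new (P - {(l, r)}) T (insert (l, r') (R - {(l, r)})) T' R' \<Longrightarrow>
    interreduce C new P T R T' R'"
| keep: "(l, r) \<in> P \<Longrightarrow> \<not> reducible C {new} l \<Longrightarrow> \<not> reducible C {new} r \<Longrightarrow>
    interreduce C new (P - {(l, r)}) T R T' R' \<Longrightarrow>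
    interreduce C new P T R T' R'"

text \<open>One iteration of the main loop on states \<open>(T, R\<^sub>f)\<close>. The algorithm is nondeterministic in
  the choice of the equation and of the normal forms.\<close>

inductive completion_step ::
  "'c set \<Rightarrow> ('c monomial \<Rightarrow> 'c monomial \<Rightarrow> bool) \<Rightarrow> 'c eqs \<times> 'c eqs \<Rightarrow> 'c eqs \<times> 'c eqs \<Rightarrow> bool"
  for C gtf where
  discard: "(l, r) \<in> T \<Longrightarrow>
    normal_form_of C R l l' \<Longrightarrow> normal_form_of C R r r' \<Longrightarrow> l' = r' \<Longrightarrow>
    completion_step C gtf (T, R) (T - {(l, r)}, R)"
| add_rule: "(l, r) \<in> T \<Longrightarrow>
    normal_form_of C R l l' \<Longrightarrow> normal_form_of C R r r' \<Longrightarrow> l' \<noteq> r' \<Longrightarrow>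
    new = (if gtf l' r' then (l', r') else (r', l')) \<Longrightarrow>
    interreduce C new R ((T - {(l, r)}) \<union> critical_pair new ` R) (insert new R) T' R' \<Longrightarrow>
    completion_step C gtf (T, R) (T', R')"

definition single_AC_completion_output ::
  "'c set \<Rightarrow> ('c \<Rightarrow> 'c \<Rightarrow> bool) \<Rightarrow> ('c monomial \<Rightarrow> 'c monomial \<Rightarrow> bool) \<Rightarrow>
   ('c \<times> 'c) set \<Rightarrow> 'c eqs \<Rightarrow> 'c eqs \<Rightarrow> bool" where
  "single_AC_completion_output C gt gtf SC Sf R \<longleftrightarrow>
     (completion_step C gtf)\<^sup>*\<^sup>* (Sf, const_rules C gt SC) ({}, R) \<and>
     (\<forall>p\<in>R. \<forall>q\<in>R. p \<noteq> q \<longrightarrow>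
        joinable C R (fst (critical_pair p q)) (snd (critical_pair p q)))"

end

theory Submission
  imports Defs "HOL.Topological_Spaces"
begin

text \<open>
  Confluence rests on the Winkler--Buchberger criterion: a terminating system is confluent if every
  critical pair is connected by a chain of equational steps all of whose monomials lie strictly
  below the peak. With the pending equations admitted in the chains, this connectedness is invariant
  under every step of the completion, whereas joinability is not. The relation generated by pending
  equations and rules is invariant as well, so the output decides \<open>ACCC(S)\<close>.
  The completion terminates because each new left-hand side is irreducible, so the ideal of reducible
  monomials grows strictly, which by Dickson's lemma happens only finitely often; in between, the
  number of pending equations decreases.
\<close>

section \<open>Dickson's lemma\<close>

text \<open>With multisets read as exponent vectors, a rule is a binomial, rewriting is monomial
  division, and a critical pair is an S-polynomial formed at the least common multiple of two
  left-hand sides. Joinability is too fragile to carry along: a join may use a rule that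
  interreduction later moves to the pending equations or alters, and the critical pairs of a new
  rule merely wait in \<open>T\<close>. A chain of equations tolerates both, provided its bound is
  kept whenever an equation is replaced. It is kept because completion changes an equation only by
  rewriting its sides downwards: the substitute chain from \<open>l\<close> down to
  \<open>l'\<close>, across to \<open>r'\<close> and up to \<open>r\<close> never rises above both
  \<open>l\<close> and \<open>r\<close>. Bounds are therefore sets closed downwards under
  \<open>gtf\<close>. Once \<open>T\<close> is empty, the chains consist of rules alone and the
  criterion applies.\<close>

text \<open>Any sequence in a linear order has a monotone subsequence, and a decreasing one in
  \<open>nat\<close> becomes constant, so its tail is nondecreasing as well.\<close>

lemma nat_mono_subseq:
  fixes f :: "nat \<Rightarrow> nat"
  shows "\<exists>\<phi> :: nat \<Rightarrow> nat. strict_mono \<phi> \<and> mono (f \<circ> \<phi>)"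
proof -
  obtain \<phi> :: "nat \<Rightarrow> nat" where \<phi>: "strict_mono \<phi>" "monoseq (\<lambda>n. f (\<phi> n))"
    using seq_monosub[of f] by blast
  from \<phi>(2) consider "incseq (\<lambda>n. f (\<phi> n))" | "decseq (\<lambda>n. f (\<phi> n))"
    by (auto simp: monoseq_iff)
  then show ?thesis
  proof cases
    case 1
    with \<phi>(1) show ?thesis
      by (auto simp: comp_def intro!: exI[of _ \<phi>])
  next
    case 2
    \<comment> \<open>The minimum of the decreasing sequence is attained at \<open>N\<close>, so the
      sequence is constant from there on.\<close>
    obtain N where N: "\<And>n. f (\<phi> N) \<le> f (\<phi> n)"
      using ex_has_least_nat[of "\<lambda>_. True" 0 "\<lambda>n. f (\<phi> n)"] by auto
    have "f (\<phi> (n + N)) = f (\<phi> N)" for n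
      using N[of "n + N"] decseqD[OF 2, of N "n + N"] by simp
    then have "mono (f \<circ> (\<lambda>n. \<phi> (n + N)))"
      by (simp add: mono_def)
    moreover have "strict_mono (\<lambda>n. \<phi> (n + N))"
      using \<phi>(1) by (simp add: strict_mono_def)
    ultimately show ?thesis
      by blast
  qed
qed

text \<open>Subsequences are refined one constant at a time; monotonicity obtained for earlier
  constants survives passing to a further subsequence.\<close>

lemma mset_mono_subseq:
  fixes M :: "nat \<Rightarrow> 'c multiset"
  assumes "finite D"
  shows "\<exists>\<phi> :: nat \<Rightarrow> nat. strict_mono \<phi> \<and> (\<forall>c\<in>D. mono (\<lambda>i. count (M (\<phi> i)) c))"
  using assms
proof induction
  case empty
  show ?case
    by (auto intro!: exI[of _ id] simp: strict_mono_def)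
next
  case (insert d D)
  then obtain \<phi> :: "nat \<Rightarrow> nat" where \<phi>: "strict_mono \<phi>" "\<forall>c\<in>D. mono (\<lambda>i. count (M (\<phi> i)) c)"
    by blast
  obtain \<psi> :: "nat \<Rightarrow> nat" where \<psi>: "strict_mono \<psi>" "mono ((\<lambda>i. count (M (\<phi> i)) d) \<circ> \<psi>)"
    using nat_mono_subseq by blast
  have "\<forall>c\<in>insert d D. mono (\<lambda>i. count (M ((\<phi> \<circ> \<psi>) i)) c)"
    using \<phi>(2) \<psi> by (auto simp: comp_def mono_def strict_mono_less_eq)
  with \<phi>(1) \<psi>(1) show ?case
    by (blast intro: strict_mono_o)
qed

lemma Dickson:
  fixes M :: "nat \<Rightarrow> 'c multiset"
  assumes "finite C" and "\<And>i. set_mset (M i) \<subseteq> C"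
  shows "\<exists>i j. i < j \<and> M i \<subseteq># M j"
proof -
  obtain \<phi> :: "nat \<Rightarrow> nat" where \<phi>: "strict_mono \<phi>" "\<forall>c\<in>C. mono (\<lambda>i. count (M (\<phi> i)) c)"
    using mset_mono_subseq[OF assms(1)] by blast
  have "count (M (\<phi> 0)) c \<le> count (M (\<phi> 1)) c" for c
  proof (cases "c \<in> C")
    case True
    with \<phi>(2) show ?thesis
      by (auto simp: mono_def)
  next
    case False
    with assms(2)[of "\<phi> 0"] have "count (M (\<phi> 0)) c = 0"
      by (metis count_eq_zero_iff subsetD)
    then show ?thesis
      by simp
  qed
  then have "M (\<phi> 0) \<subseteq># M (\<phi> 1)"
    by (simp add: subseteq_mset_def)
  moreover have "\<phi> 0 < \<phi> 1"
    using \<phi>(1) by (simp add: strict_mono_def)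
  ultimately show ?thesis
    by blast
qed

text \<open>These are the monomial ideals in the variables \<open>C\<close>, given by exponent
  vectors; the empty multiset plays the unit monomial.\<close>

definition mset_ideals :: "'c set \<Rightarrow> 'c multiset set set" where
  "mset_ideals C = {I. \<forall>M\<in>I. \<forall>N. M \<subseteq># N \<and> set_mset N \<subseteq> C \<longrightarrow> N \<in> I} \<inter>
     Pow {M. set_mset M \<subseteq> C}"

text \<open>Noetherianity: choose in each step of an ascending chain an element that is new there.
  Dickson's lemma finds an earlier choice dividing a later one, which then was not new.\<close>

lemma wf_ascending_ideals:
  assumes "finite C"
  shows "wf {(J, I). I \<in> mset_ideals C \<and> J \<in> mset_ideals C \<and> I \<subset> J}"
  unfolding wf_iff_no_infinite_down_chain
proof
  assume "\<exists>I. \<forall>i. (I (Suc i), I i) \<in> {(J, I). I \<in> mset_ideals C \<and> J \<in> mset_ideals C \<and> I \<subset> J}"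
  then obtain I where I: "\<And>i. I i \<in> mset_ideals C" "\<And>i. I i \<subset> I (Suc i)"
    by blast
  then have "\<forall>i. \<exists>M. M \<in> I (Suc i) \<and> M \<notin> I i"
    by blast
  then obtain M where M: "\<And>i. M i \<in> I (Suc i)" "\<And>i. M i \<notin> I i"
    by metis
  have C: "set_mset (M i) \<subseteq> C" for i
    using I(1)[of "Suc i"] M(1)[of i] by (auto simp: mset_ideals_def)
  then obtain i j where ij: "i < j" "M i \<subseteq># M j"
    using Dickson[OF assms] by blast
  have "I (Suc i) \<subseteq> I j"
    by (rule lift_Suc_mono_le) (use ij(1) I(2) in auto)
  then have "M i \<in> I j"
    using M(1) by blast
  then have "M j \<in> I j"
    using I(1)[of j] ij(2) C[of j] by (auto simp: mset_ideals_def)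
  with M(2) show False
    by blast
qed

section \<open>Conversion within a set of monomials\<close>

lemma monomials_add [simp]: "s \<in> monomials C \<Longrightarrow> set_mset N \<subseteq> C \<Longrightarrow> s + N \<in> monomials C"
  by (auto simp: monomials_def)

lemma monomials_diff_add:
  "M \<in> monomials C \<Longrightarrow> B \<in> monomials C \<Longrightarrow> M - A + B \<in> monomials C"
  by (auto simp: monomials_def dest: in_diffD)

lemma ACCC_monomials:
  assumes "E \<subseteq> monomials C \<times> monomials C" and "(s, t) \<in> ACCC C E"
  shows "s \<in> monomials C \<and> t \<in> monomials C"
  using assms(2,1) by induction (auto simp: monomials_def)

lemma ACCC_context:
  assumes "(s, t) \<in> ACCC C E" and "set_mset N \<subseteq> C"
  shows "(s + N, t + N) \<in> ACCC C E"
\<comment> \<open>The empty multiset is no monomial, so \<open>ACCC.refl\<close> does not cover it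
  as a context.\<close>
proof (cases "N = {#}")
  case False
  with assms show ?thesis
    by (intro ACCC.cong ACCC.refl) (auto simp: monomials_def)
qed (use assms in simp)

lemma ACCC_subset:
  assumes "E \<subseteq> ACCC C E'"
  shows "ACCC C E \<subseteq> ACCC C E'"
proof (rule subrelI)
  show "(s, t) \<in> ACCC C E'" if "(s, t) \<in> ACCC C E" for s t
    using that assms by induction (auto intro: ACCC.intros)
qed

text \<open>The bound \<open>Q\<close> is imposed on the whole monomials \<open>s\<close> and
  \<open>t\<close>, not on the sides of the equation applied, so that every point of a chain of at
  least one step lies in \<open>Q\<close>. The choice \<open>Q = monomials C\<close> gives ordinary
  equational reasoning.\<close>

definition estep :: "'c monomial set \<Rightarrow> 'c eqs \<Rightarrow> 'c monomial \<Rightarrow> 'c monomial \<Rightarrow> bool" where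
  "estep Q E s t \<longleftrightarrow> s \<in> Q \<and> t \<in> Q \<and>
     (\<exists>A B N. ((A, B) \<in> E \<or> (B, A) \<in> E) \<and> s = A + N \<and> t = B + N)"

abbreviation conv :: "'c monomial set \<Rightarrow> 'c eqs \<Rightarrow> 'c monomial \<Rightarrow> 'c monomial \<Rightarrow> bool" where
  "conv Q E \<equiv> (estep Q E)\<^sup>*\<^sup>*"

lemma conv_sym: "conv Q E s t \<Longrightarrow> conv Q E t s"
  by (rule sympD[OF symp_rtranclp]) (auto simp: symp_def estep_def)

text \<open>Two bounds \<open>Q\<close> and \<open>Q'\<close> occur because a context shifts the
  bound: a chain below \<open>L\<close> becomes one below \<open>L + N\<close>.\<close>

lemma conv_context:
  assumes "conv Q E s t" and "\<And>X. X \<in> Q \<Longrightarrow> X + N \<in> Q'"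
  shows "conv Q' E (s + N) (t + N)"
  using assms(1)
proof induction
  case (step y z)
  from step(2) obtain A B K where "(A, B) \<in> E \<or> (B, A) \<in> E" "y = A + K" "z = B + K"
    "y \<in> Q" "z \<in> Q"
    by (auto simp: estep_def)
  then have "estep Q' E (y + N) (z + N)"
    unfolding estep_def by (intro conjI assms(2) exI[of _ A] exI[of _ B] exI[of _ "K + N"])
      (simp_all add: add.assoc)
  with step.IH show ?case
    by (rule rtranclp.rtrancl_into_rtrancl)
qed simp

lemma estep_base: "(A, B) \<in> E \<Longrightarrow> A \<in> Q \<Longrightarrow> B \<in> Q \<Longrightarrow> estep Q E A B"
  unfolding estep_def by (metis add.right_neutral)

lemma conv_imp_ACCC:
  assumes "conv (monomials C) E s t" and "s \<in> monomials C"
  shows "(s, t) \<in> ACCC C E"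
  using assms
proof induction
  case (step y z)
  then obtain A B N where "(A, B) \<in> E \<or> (B, A) \<in> E" "y = A + N" "z = B + N" "y \<in> monomials C"
    by (auto simp: estep_def)
  then have "(y, z) \<in> ACCC C E"
    by (auto simp: monomials_def intro!: ACCC_context intro: ACCC.base ACCC.sym)
  with step show ?case
    by (blast intro: ACCC.trans)
qed (simp add: ACCC.refl)

lemma ACCC_imp_conv:
  assumes E: "E \<subseteq> monomials C \<times> monomials C" and "(s, t) \<in> ACCC C E"
  shows "conv (monomials C) E s t"
  using assms(2)
proof induction
  case (base s t)
  with E show ?case
    by (auto intro: estep_base)
next
  case (cong M1 M2 N1 N2)
  from cong(1,2) E have sub: "set_mset N1 \<subseteq> C" "set_mset M2 \<subseteq> C"
    by (auto simp: monomials_def dest!: ACCC_monomials[OF E])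
  \<comment> \<open>Congruence changes both summands at once, a chain one after the other, with
    \<open>M2 + N1\<close> in between.\<close>
  have "conv (monomials C) E (M1 + N1) (M2 + N1)"
    using cong.IH(1) sub(1) by (auto intro: conv_context)
  moreover have "conv (monomials C) E (N1 + M2) (N2 + M2)"
    using cong.IH(2) sub(2) by (auto intro: conv_context)
  ultimately show ?case
    by (simp add: add.commute)
qed (auto intro: conv_sym)

section \<open>Rewrite steps, their contexts and critical pairs\<close>

lemma rstep_imp_ACCC:
  assumes "rstep C R s t"
  shows "(s, t) \<in> ACCC C R"
  using assms
proof cases
  case (1 A B)
  have "(A + (s - A), B + (s - A)) \<in> ACCC C R"
    using 1 by (intro ACCC_context ACCC.base) (auto simp: monomials_def dest: in_diffD)
  with 1 show ?thesis
    by (simp add: add.commute)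
qed

lemma rsteps_imp_ACCC:
  assumes "(rstep C R)\<^sup>*\<^sup>* s t" and "s \<in> monomials C"
  shows "(s, t) \<in> ACCC C R"
  using assms by induction (auto intro: ACCC.refl ACCC.trans rstep_imp_ACCC)

lemma ACCC_mono: "E \<subseteq> E' \<Longrightarrow> ACCC C E \<subseteq> ACCC C E'"
  by (rule ACCC_subset) (auto intro: ACCC.base)

lemma rstep_context:
  assumes "rstep C R s t" and "set_mset N \<subseteq> C"
  shows "rstep C R (s + N) (t + N)"
  using assms(1)
proof cases
  case (1 A B)
  then have "rstep C R (s + N) (s + N - A + B)"
    using assms(2) by (intro rstep.intros) (auto intro: subset_mset.add_increasing2)
  moreover have "s + N - A = s - A + N"
    by (rule subset_mset.diff_add_assoc2) (use 1 in simp)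
  then have "s + N - A + B = t + N"
    using 1(1) by (simp only: ac_simps)
  ultimately show ?thesis
    by simp
qed

lemma rsteps_context:
  assumes "(rstep C R)\<^sup>*\<^sup>* s t" and "set_mset N \<subseteq> C"
  shows "(rstep C R)\<^sup>*\<^sup>* (s + N) (t + N)"
  using assms by induction (auto intro: rstep_context rtranclp.rtrancl_into_rtrancl)

lemma reducible_iff: "reducible C R M \<longleftrightarrow> M \<in> monomials C \<and> (\<exists>(A, B)\<in>R. A \<subseteq># M)"
  by (auto simp: reducible_def elim!: rstep.cases intro: rstep.intros)

text \<open>Sum minus intersection is the pointwise maximum, so the superposition \<open>AB\<close>
  is the least common multiple of the left-hand sides. Disjoint left-hand sides are included, hence
  local peaks need no separate case for them.\<close>

lemma critical_pair_sup:
  "critical_pair (A1, A2) (B1, B2) = (A1 \<union># B1 - A1 + A2, A1 \<union># B1 - B1 + B2)"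
  by (simp add: union_diff_inter_eq_sup Let_def)

lemma critical_pair_swap: "critical_pair q p = prod.swap (critical_pair p q)"
  by (cases p; cases q)
    (simp only: critical_pair_sup prod.swap_def fst_conv snd_conv subset_mset.sup_commute)


section \<open>Oriented rules and conversion below a bound\<close>

text \<open>Collects the properties of an admissible ordering that concern \<open>gtf\<close> alone;
  the link with \<open>gt\<close> enters only with the constant rules.\<close>

locale monomial_order =
  fixes C :: "'c set" and gtf :: "'c monomial \<Rightarrow> 'c monomial \<Rightarrow> bool"
  assumes gtf_irrefl: "s \<in> monomials C \<Longrightarrow> \<not> gtf s s"
    and gtf_trans: "s \<in> monomials C \<Longrightarrow> t \<in> monomials C \<Longrightarrow> u \<in> monomials C \<Longrightarrow>
      gtf s t \<Longrightarrow> gtf t u \<Longrightarrow> gtf s u"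
    and gtf_total: "s \<in> monomials C \<Longrightarrow> t \<in> monomials C \<Longrightarrow> s \<noteq> t \<Longrightarrow> gtf s t \<or> gtf t s"
    and gtf_wf: "wfp_on (monomials C) gtf\<inverse>\<inverse>"
    and gtf_subset: "A \<in> monomials C \<Longrightarrow> B \<in> monomials C \<Longrightarrow> B \<subset># A \<Longrightarrow> gtf A B"
    and gtf_add_monomial: "A \<in> monomials C \<Longrightarrow> B \<in> monomials C \<Longrightarrow> N \<in> monomials C \<Longrightarrow>
      gtf A B \<Longrightarrow> gtf (A + N) (B + N)"
begin

lemma gtf_add:
  assumes "A \<in> monomials C" and "B \<in> monomials C" and "set_mset N \<subseteq> C" and "gtf A B"
  shows "gtf (A + N) (B + N)"
proof (cases "N = {#}")
  case False
  with assms show ?thesis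
    by (intro gtf_add_monomial) (auto simp: monomials_def)
qed (use assms in simp)

definition oriented :: "'c eqs \<Rightarrow> bool" where
  "oriented R \<longleftrightarrow> R \<subseteq> monomials C \<times> monomials C \<and> (\<forall>(l, r)\<in>R. gtf l r)"

lemma orientedD:
  assumes "oriented R" and "(l, r) \<in> R"
  shows "l \<in> monomials C" and "r \<in> monomials C" and "gtf l r"
  using assms by (auto simp: oriented_def)

lemma oriented_subset: "oriented R \<Longrightarrow> R' \<subseteq> R \<Longrightarrow> oriented R'"
  by (auto simp: oriented_def)

lemma oriented_insert:
  "oriented R \<Longrightarrow> l \<in> monomials C \<Longrightarrow> r \<in> monomials C \<Longrightarrow> gtf l r \<Longrightarrow> oriented (insert (l, r) R)"
  by (auto simp: oriented_def)

lemma rule_step_gtf: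
  assumes "A \<in> monomials C" and "B \<in> monomials C" and "gtf A B"
    and "M \<in> monomials C" and "A \<subseteq># M"
  shows "gtf M (M - A + B)"
proof -
  have "gtf (A + (M - A)) (B + (M - A))"
    using assms by (intro gtf_add) (auto simp: monomials_def dest: in_diffD)
  with assms(5) show ?thesis
    by (simp add: add.commute)
qed

lemma rstep_gtf:
  assumes "oriented R" and "rstep C R s t"
  shows "s \<in> monomials C \<and> t \<in> monomials C \<and> gtf s t"
  using assms(2)
proof cases
  case (1 A B)
  then have "A \<in> monomials C" "B \<in> monomials C" "gtf A B"
    using assms(1) by (auto simp: oriented_def)
  with 1 show ?thesis
    using rule_step_gtf monomials_diff_add by blast
qed

lemma rsteps_gtf:
  assumes "oriented R" and "(rstep C R)\<^sup>*\<^sup>* s t" and "s \<in> monomials C"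
  shows "t \<in> monomials C \<and> (t = s \<or> gtf s t)"
  using assms(2)
proof induction
  case (step y z)
  then show ?case
    using rstep_gtf[OF assms(1) step(2)] gtf_trans assms(3) by blast
qed (simp add: assms)

lemma wfp_rstep:
  assumes "oriented R"
  shows "wfp (rstep C R)\<inverse>\<inverse>"
proof -
  have "wfp (\<lambda>x y. gtf\<inverse>\<inverse> x y \<and> x \<in> monomials C \<and> y \<in> monomials C)"
    using gtf_wf by (rule wfp_on_iff_wfp[THEN iffD1])
  then show ?thesis
    unfolding wfp_def by (rule wf_subset) (auto dest: rstep_gtf[OF assms])
qed

lemma normal_form_exists:
  assumes "oriented R"
  shows "\<exists>u. normal_form_of C R s u"
  using wfp_rstep[OF assms]
proof (induction s rule: wfp_induct_rule)
  case (less s)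
  show ?case
  proof (cases "reducible C R s")
    case True
    then obtain t where "rstep C R s t"
      by (auto simp: reducible_def)
    with less[of t] show ?thesis
      by (auto simp: normal_form_of_def intro: converse_rtranclp_into_rtranclp)
  qed (auto simp: normal_form_of_def)
qed

section \<open>Down-sets as bounds on chains\<close>

text \<open>Downward closure lets rewriting that starts in \<open>Q\<close> stay in
  \<open>Q\<close>. The bounds in use are \<open>monomials C\<close> for unrestricted reasoning and
  \<open>below b\<close> for chains strictly under a peak \<open>b\<close>.\<close>

definition downset :: "'c monomial set \<Rightarrow> bool" where
  "downset Q \<longleftrightarrow> Q \<subseteq> monomials C \<and> (\<forall>X\<in>Q. \<forall>Y\<in>monomials C. gtf X Y \<longrightarrow> Y \<in> Q)"

definition below :: "'c monomial \<Rightarrow> 'c monomial set" where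
  "below b = {X \<in> monomials C. gtf b X}"

lemma downset_monomials: "downset (monomials C)"
  by (simp add: downset_def)

lemma downset_below: "b \<in> monomials C \<Longrightarrow> downset (below b)"
  unfolding downset_def below_def using gtf_trans by blast

lemma rsteps_imp_conv:
  assumes "oriented R" and "(rstep C R)\<^sup>*\<^sup>* s t" and "downset Q" and "s \<in> Q" and "R \<subseteq> E"
  shows "conv Q E s t \<and> t \<in> Q"
  using assms(2)
proof induction
  case (step y z)
  note z = rstep_gtf[OF assms(1) step(2)]
  then have "z \<in> Q"
    using step.IH assms(3) by (auto simp: downset_def)
  moreover from step(2) have "estep Q E y z"
  proof cases
    case (1 A B)
    then have "y = A + (y - A)" "z = B + (y - A)"
      by (simp_all add: add.commute)
    moreover have "(A, B) \<in> E"
      using 1 assms(5) by auto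
    ultimately show ?thesis
      using step.IH \<open>z \<in> Q\<close> unfolding estep_def by blast
  qed
  ultimately show ?case
    using step.IH by (auto intro: rtranclp.rtrancl_into_rtrancl)
qed (use assms in auto)

text \<open>Quantifying over all down-sets makes replacing an equation respect every bound at once,
  in particular the peak of any critical pair.\<close>

definition simulated :: "'c eqs \<Rightarrow> 'c eqs \<Rightarrow> bool" where
  "simulated E E' \<longleftrightarrow>
     (\<forall>(A, B)\<in>E. \<forall>Q. downset Q \<longrightarrow> A \<in> Q \<longrightarrow> B \<in> Q \<longrightarrow> conv Q E' A B)"

lemma simulated_subset: "E \<subseteq> E' \<Longrightarrow> simulated E E'"
  by (auto simp: simulated_def intro: estep_base)

text \<open>An equation applied in a context \<open>N\<close> is simulated without the context,
  under the bound \<open>Q\<close> divided by \<open>N\<close>, and the context is then added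
  back.\<close>

lemma simulated_conv:
  assumes sim: "simulated E E'" and E: "E \<subseteq> monomials C \<times> monomials C"
    and Q: "downset Q" and "conv Q E s t"
  shows "conv Q E' s t"
  using assms(4)
proof induction
  case (step y z)
  then obtain A B N where AB: "(A, B) \<in> E \<or> (B, A) \<in> E" and yz: "y = A + N" "z = B + N"
    and yzQ: "y \<in> Q" "z \<in> Q"
    by (auto simp: estep_def)
  have "y \<in> monomials C"
    using yzQ(1) Q by (auto simp: downset_def)
  then have N: "set_mset N \<subseteq> C"
    by (auto simp: yz monomials_def)
  \<comment> \<open>This quotient of \<open>Q\<close> by \<open>N\<close> is again a down-set,
    because \<open>gtf\<close> is compatible with adding \<open>N\<close>.\<close>
  define Q' where "Q' = {X \<in> monomials C. X + N \<in> Q}"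
  have "downset Q'"
    using Q N gtf_add by (auto simp: downset_def Q'_def)
  moreover have "A \<in> Q'" "B \<in> Q'"
    using AB E yz yzQ by (auto simp: Q'_def)
  ultimately have "conv Q' E' A B"
    using AB sim unfolding simulated_def by (blast intro: conv_sym)
  then have "conv Q E' y z"
    unfolding yz by (rule conv_context) (simp add: Q'_def)
  with step.IH show ?case
    by simp
qed simp

lemma simulated_trans:
  assumes "simulated E E'" and "simulated E' E''" and "E' \<subseteq> monomials C \<times> monomials C"
  shows "simulated E E''"
  using assms(1) simulated_conv[OF assms(2,3)] unfolding simulated_def by blast

lemma simulated_imp_ACCC:
  assumes "simulated E E'" and "E \<subseteq> monomials C \<times> monomials C"
  shows "ACCC C E \<subseteq> ACCC C E'"
proof (rule ACCC_subset, rule subrelI)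
  fix s t
  assume "(s, t) \<in> E"
  then show "(s, t) \<in> ACCC C E'"
    using assms downset_monomials unfolding simulated_def by (intro conv_imp_ACCC) blast+
qed

section \<open>Confluence from connected critical pairs\<close>

text \<open>The equations \<open>E\<close> allowed in chains are kept apart from the rules
  \<open>R\<close> forming the pairs: during completion \<open>E\<close> is
  \<open>T \<union> R\<close>, and at the end both coincide.\<close>

definition connected_pairs :: "'c eqs \<Rightarrow> 'c eqs \<Rightarrow> bool" where
  "connected_pairs E R \<longleftrightarrow> (\<forall>p\<in>R. \<forall>q\<in>R. p \<noteq> q \<longrightarrow>
     conv (below (fst p \<union># fst q)) E (fst (critical_pair p q)) (snd (critical_pair p q)))"

lemma connected_pair_swap:
  "conv (below (fst q \<union># fst p)) E (fst (critical_pair q p)) (snd (critical_pair q p)) \<longleftrightarrow>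
   conv (below (fst p \<union># fst q)) E (fst (critical_pair p q)) (snd (critical_pair p q))"
  by (auto simp: critical_pair_swap[of q p] subset_mset.sup_commute[of "fst q"] intro: conv_sym)

lemma sup_monomials [simp]:
  "A \<in> monomials C \<Longrightarrow> B \<in> monomials C \<Longrightarrow> A \<union># B \<in> monomials C"
  by (auto simp: monomials_def)

lemma connected_pairs_simulated:
  assumes "connected_pairs E R" and "simulated E E'" and "R' \<subseteq> R" and "oriented R"
    and "E \<subseteq> monomials C \<times> monomials C"
  shows "connected_pairs E' R'"
  unfolding connected_pairs_def
proof (intro ballI impI)
  fix p q
  assume pq: "p \<in> R'" "q \<in> R'" "p \<noteq> q"
  then have "fst p \<union># fst q \<in> monomials C"
    using orientedD[OF assms(4)] assms(3) by (metis prod.collapse subsetD sup_monomials)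
  then show "conv (below (fst p \<union># fst q)) E' (fst (critical_pair p q)) (snd (critical_pair p q))"
    using pq assms by (intro simulated_conv[OF assms(2,5)] downset_below)
      (auto simp: connected_pairs_def)
qed

lemma critical_pair_below:
  assumes "oriented {p, q}"
  shows "fst (critical_pair p q) \<in> below (fst p \<union># fst q)"
    and "snd (critical_pair p q) \<in> below (fst p \<union># fst q)"
proof -
  obtain A1 A2 B1 B2 where pq: "p = (A1, A2)" "q = (B1, B2)"
    by (cases p; cases q) auto
  have m: "A1 \<in> monomials C" "A2 \<in> monomials C" "B1 \<in> monomials C" "B2 \<in> monomials C"
    "gtf A1 A2" "gtf B1 B2"
    using assms by (auto simp: oriented_def pq)
  then have "gtf (A1 \<union># B1) (A1 \<union># B1 - A1 + A2)" "gtf (A1 \<union># B1) (A1 \<union># B1 - B1 + B2)"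
    by (auto intro!: rule_step_gtf simp del: subset_mset.add_diff_assoc2)
  with m show "fst (critical_pair p q) \<in> below (fst p \<union># fst q)"
    and "snd (critical_pair p q) \<in> below (fst p \<union># fst q)"
    unfolding pq critical_pair_sup below_def
    by (auto intro!: monomials_diff_add simp del: subset_mset.add_diff_assoc2)
qed

text \<open>Both left-hand sides lie within their least common multiple \<open>L\<close>, so the
  peak is a critical peak plus a common context \<open>N\<close>. Adding \<open>N\<close> turns a
  chain below \<open>L\<close> into one below \<open>s\<close>.\<close>

lemma local_peak_connected:
  assumes R: "oriented R" and "connected_pairs R R" and a: "rstep C R s a" and b: "rstep C R s b"
  shows "conv (below s) R a b"
proof -
  obtain A1 A2 where A: "(A1, A2) \<in> R" "A1 \<subseteq># s" "a = s - A1 + A2" "s \<in> monomials C"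
    using a by (auto elim: rstep.cases)
  obtain B1 B2 where B: "(B1, B2) \<in> R" "B1 \<subseteq># s" "b = s - B1 + B2"
    using b by (auto elim: rstep.cases)
  show ?thesis
  proof (cases "(A1, A2) = (B1, B2)")
    \<comment> \<open>On multisets a rule applies to \<open>s\<close> in only one way, so the two
      results are equal.\<close>
    case True
    with A B show ?thesis
      by simp
  next
    case False
    define L where "L = A1 \<union># B1"
    define N where "N = s - L"
    have "L \<subseteq># s"
      using A B by (simp add: L_def)
    then have s: "s = L + N"
      by (simp add: N_def)
    have N: "set_mset N \<subseteq> C"
      using A(4) s by (auto simp: monomials_def)
    have "A1 \<subseteq># L" "B1 \<subseteq># L"
      by (simp_all add: L_def)
    then have "s - A1 = L - A1 + N" "s - B1 = L - B1 + N"
      by (simp_all add: s)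
    then have ab: "a = L - A1 + A2 + N" "b = L - B1 + B2 + N"
      unfolding A B by (simp_all only: ac_simps)
    have L: "L \<in> monomials C"
      unfolding L_def using orientedD[OF R] A(1) B(1) by simp
    have "conv (below L) R (L - A1 + A2) (L - B1 + B2)"
      using assms(2) A(1) B(1) False unfolding connected_pairs_def L_def
      by (metis critical_pair_sup fst_conv snd_conv)
    then show ?thesis
      unfolding ab by (rule conv_context) (use s N L gtf_add in \<open>auto simp: below_def\<close>)
  qed
qed

text \<open>A Church-Rosser argument with confluence assumed only at points of \<open>Q\<close>.
  This allows \<open>Q = below s\<close> inside an induction on \<open>s\<close>, where just the
  smaller monomials are known to be confluent.\<close>

lemma conv_imp_joinable:
  assumes "conv Q R a b"
    and "\<And>x y z. x \<in> Q \<Longrightarrow> (rstep C R)\<^sup>*\<^sup>* x y \<Longrightarrow> (rstep C R)\<^sup>*\<^sup>* x z \<Longrightarrow> joinable C R y z"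
    and "R \<subseteq> monomials C \<times> monomials C" and "Q \<subseteq> monomials C"
  shows "joinable C R a b"
  using assms(1)
proof induction
  case base
  show ?case
    by (auto simp: joinable_def)
next
  case (step y z)
  then obtain A B N where AB: "(A, B) \<in> R \<or> (B, A) \<in> R" and yz: "y = A + N" "z = B + N"
    and Q: "y \<in> Q" "z \<in> Q"
    by (auto simp: estep_def)
  from step.IH obtain v where v: "(rstep C R)\<^sup>*\<^sup>* a v" "(rstep C R)\<^sup>*\<^sup>* y v"
    by (auto simp: joinable_def)
  from AB show ?case
  proof
    assume "(A, B) \<in> R"
    then have "rstep C R y (y - A + B)"
      using Q assms(4) by (intro rstep.intros) (auto simp: yz)
    then have "rstep C R y z"
      by (simp add: yz add.commute)
    \<comment> \<open>A forward step creates a peak at \<open>y\<close>, closed by confluence there;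
      a backward step merely lengthens the path from \<open>z\<close>.\<close>
    with assms(2)[OF Q(1) v(2)] obtain w where "(rstep C R)\<^sup>*\<^sup>* v w" "(rstep C R)\<^sup>*\<^sup>* z w"
      by (auto simp: joinable_def)
    with v show ?thesis
      by (auto simp: joinable_def intro: rtranclp_trans)
  next
    assume "(B, A) \<in> R"
    then have "rstep C R z (z - B + A)"
      using Q assms(4) by (intro rstep.intros) (auto simp: yz)
    then have "rstep C R z y"
      by (simp add: yz add.commute)
    with v show ?thesis
      by (auto simp: joinable_def intro: converse_rtranclp_into_rtranclp)
  qed
qed

text \<open>Newman's argument by induction on the peak \<open>s\<close>: all points of the chain
  connecting the two first reducts are below \<open>s\<close>, so the induction hypothesis turns
  that chain into a join.\<close>

lemma connected_pairs_confluent: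
  assumes R: "oriented R" and "connected_pairs R R"
  shows "confluentp (rstep C R)"
proof -
  have sub: "R \<subseteq> monomials C \<times> monomials C"
    using R by (simp add: oriented_def)
  have conf: "joinable C R t1 t2"
    if "s \<in> monomials C" "(rstep C R)\<^sup>*\<^sup>* s t1" "(rstep C R)\<^sup>*\<^sup>* s t2" for s t1 t2
    using that
  proof (induction s arbitrary: t1 t2 rule: wfp_on_induct[OF gtf_wf, consumes 1, case_names less])
    case (less s)
    note IH = less.IH
    show ?case
    proof (cases "s = t1 \<or> s = t2")
      case True
      with less.prems show ?thesis
        by (auto simp: joinable_def)
    next
      case False
      then obtain a b where a: "rstep C R s a" "(rstep C R)\<^sup>*\<^sup>* a t1"
        and b: "rstep C R s b" "(rstep C R)\<^sup>*\<^sup>* b t2"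
        using less.prems by (metis converse_rtranclpE)
      have ab: "a \<in> monomials C" "gtf s a" "b \<in> monomials C" "gtf s b"
        using rstep_gtf[OF R] a b by blast+
      have "joinable C R a b"
        by (rule conv_imp_joinable[OF local_peak_connected[OF R assms(2) a(1) b(1)] _ sub])
          (use IH in \<open>auto simp: below_def\<close>)
      then obtain c where c: "(rstep C R)\<^sup>*\<^sup>* a c" "(rstep C R)\<^sup>*\<^sup>* b c"
        by (auto simp: joinable_def)
      obtain d where d: "(rstep C R)\<^sup>*\<^sup>* t1 d" "(rstep C R)\<^sup>*\<^sup>* c d"
        using IH[of a t1 c] ab a c by (auto simp: joinable_def)
      obtain e where "(rstep C R)\<^sup>*\<^sup>* d e" "(rstep C R)\<^sup>*\<^sup>* t2 e"
        using IH[of b d t2] ab b c d by (auto simp: joinable_def intro: rtranclp_trans)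
      with d show ?thesis
        by (auto simp: joinable_def intro: rtranclp_trans)
    qed
  qed
  show ?thesis
  proof (rule confluentpI)
    fix x y z
    assume "(rstep C R)\<^sup>*\<^sup>* x y" "(rstep C R)\<^sup>*\<^sup>* x z"
    \<comment> \<open>Outside \<open>monomials C\<close> no step exists, so a peak there is
      trivial.\<close>
    moreover have "x \<in> monomials C" if "x \<noteq> y"
      using that calculation(1) by (metis converse_rtranclpE rstep_gtf[OF R])
    ultimately show "\<exists>u. (rstep C R)\<^sup>*\<^sup>* y u \<and> (rstep C R)\<^sup>*\<^sup>* z u"
      using conf unfolding joinable_def by blast
  qed
qed

section \<open>Invariants of completion\<close>

definition valid_state :: "'c eqs \<Rightarrow> 'c eqs \<Rightarrow> bool" where
  "valid_state T R \<longleftrightarrow>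
     finite T \<and> finite R \<and> T \<subseteq> monomials C \<times> monomials C \<and> oriented R"

lemma valid_state_sub: "valid_state T R \<Longrightarrow> T \<union> R \<subseteq> monomials C \<times> monomials C"
  by (auto simp: valid_state_def oriented_def)

text \<open>Bundles everything preserved, as a transitive relation, so that each elementary change
  can be treated alone. \<open>simulated\<close> transports the bounded chains forward and yields
  one inclusion of the generated relations; the converse inclusion carries no bound. Growth of
  reducibility serves termination.\<close>

definition refines :: "'c eqs \<Rightarrow> 'c eqs \<Rightarrow> 'c eqs \<Rightarrow> 'c eqs \<Rightarrow> bool" where
  "refines T R T' R' \<longleftrightarrow>
     valid_state T' R' \<and> simulated (T \<union> R) (T' \<union> R') \<and> T' \<union> R' \<subseteq> ACCC C (T \<union> R) \<and>
     (\<forall>M. reducible C R M \<longrightarrow> reducible C R' M) \<and>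
     (connected_pairs (T \<union> R) R \<longrightarrow> connected_pairs (T' \<union> R') R')"

lemma refines_valid: "refines T R T' R' \<Longrightarrow> valid_state T' R'"
  by (simp add: refines_def)

lemma refines_refl: "valid_state T R \<Longrightarrow> refines T R T R"
  by (auto simp: refines_def intro: simulated_subset ACCC.base)

lemma refines_trans:
  assumes "refines T R T' R'" and "refines T' R' T'' R''"
  shows "refines T R T'' R''"
proof -
  have "ACCC C (T' \<union> R') \<subseteq> ACCC C (T \<union> R)"
    using assms(1) by (intro ACCC_subset) (simp add: refines_def)
  then show ?thesis
    using assms simulated_trans[OF _ _ valid_state_sub[OF refines_valid[OF assms(1)]]]
    unfolding refines_def by blast
qed

lemma refines_ACCC:
  assumes "valid_state T R" and "refines T R T' R'"
  shows "ACCC C (T' \<union> R') = ACCC C (T \<union> R)"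
proof
  show "ACCC C (T' \<union> R') \<subseteq> ACCC C (T \<union> R)"
    using assms(2) by (intro ACCC_subset) (simp add: refines_def)
  show "ACCC C (T \<union> R) \<subseteq> ACCC C (T' \<union> R')"
    using assms by (intro simulated_imp_ACCC valid_state_sub) (simp_all add: refines_def)
qed

text \<open>The union of equations and rules is unchanged. Reducibility survives because the
  left-hand side of \<open>new\<close> divides \<open>l\<close>, hence every monomial that
  \<open>l\<close> divides.\<close>

lemma refines_move:
  assumes "valid_state T R" and "(l, r) \<in> R" and "new \<in> R" and "new \<noteq> (l, r)"
    and "reducible C {new} l"
  shows "refines T R (insert (l, r) T) (R - {(l, r)})"
  unfolding refines_def
proof (intro conjI allI impI)
  have R: "oriented R"
    using assms(1) by (simp add: valid_state_def)
  have eq: "insert (l, r) T \<union> (R - {(l, r)}) = T \<union> R"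
    using assms(2) by auto
  show "valid_state (insert (l, r) T) (R - {(l, r)})"
    using assms(1) orientedD[OF R assms(2)] by (auto simp: valid_state_def intro: oriented_subset)
  show sim: "simulated (T \<union> R) (insert (l, r) T \<union> (R - {(l, r)}))"
    unfolding eq by (rule simulated_subset) simp
  show "insert (l, r) T \<union> (R - {(l, r)}) \<subseteq> ACCC C (T \<union> R)"
    unfolding eq by (auto intro: ACCC.base)
  show "reducible C (R - {(l, r)}) M" if red: "reducible C R M" for M
  proof -
    obtain A B where AB: "(A, B) \<in> R" "A \<subseteq># M" "M \<in> monomials C"
      using red by (auto simp: reducible_iff)
    have "fst new \<subseteq># l"
      using assms(5) by (auto simp: reducible_iff)
    then have "fst new \<subseteq># M" if "(A, B) = (l, r)"
      using that AB by auto
    with AB assms(3,4) show ?thesis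
      unfolding reducible_iff by (cases "(A, B) = (l, r)"; cases new) force+
  qed
  show "connected_pairs (insert (l, r) T \<union> (R - {(l, r)})) (R - {(l, r)})"
    if "connected_pairs (T \<union> R) R"
    by (rule connected_pairs_simulated[OF that sim _ R valid_state_sub[OF assms(1)]]) auto
qed

text \<open>The right-hand side of a rule is normalized by a system that still contains this rule; being
  smaller than the left-hand side, it cannot be rewritten by it.\<close>

lemma rsteps_remove_rule:
  assumes R: "oriented R" and "(rstep C R)\<^sup>*\<^sup>* u t"
    and l: "l \<in> monomials C" and u: "u \<in> monomials C" "gtf l u"
  shows "(rstep C (R - {(l, r)}))\<^sup>*\<^sup>* u t"
  using assms(2)
proof induction
  case (step y z)
  have y: "y \<in> monomials C" "gtf l y"
    using rsteps_gtf[OF R step(1) u(1)] gtf_trans l u by blast+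
  have "\<not> l \<subseteq># y"
  proof
    assume "l \<subseteq># y"
    then have "y = l \<or> gtf y l"
      using gtf_subset[OF y(1) l] by (auto simp: subset_mset.le_less)
    then show False
      using y l gtf_irrefl gtf_trans by blast
  qed
  with step(2) have "rstep C (R - {(l, r)}) y z"
    by (auto elim!: rstep.cases intro!: rstep.intros)
  with step.IH show ?case
    by (rule rtranclp.rtrancl_into_rtrancl)
qed simp

lemma simplified_rule_gtf:
  assumes "oriented R" and "(l, r) \<in> R" and "new \<in> R" and "rstep C {new} r u"
    and "(rstep C R)\<^sup>*\<^sup>* u r'"
  shows "u \<in> monomials C" and "gtf l u" and "r' \<in> monomials C" and "gtf l r'"
proof -
  note lr = orientedD[OF assms(1,2)]
  have "oriented {new}"
    using assms(1) by (rule oriented_subset) (use assms(3) in simp)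
  then show u: "u \<in> monomials C" "gtf l u"
    using rstep_gtf[OF _ assms(4)] lr gtf_trans by blast+
  show "r' \<in> monomials C" "gtf l r'"
    using rsteps_gtf[OF assms(1,5) u(1)] u lr gtf_trans by blast+
qed

text \<open>The remaining rules rewrite \<open>r\<close> to \<open>r'\<close>, so the old rule is
  recovered as a chain through \<open>r'\<close>. It must not be used in its own replacement, which
  is why the path avoids \<open>(l, r)\<close>.\<close>

lemma refines_simplify:
  assumes "valid_state T R" and lr: "(l, r) \<in> R" and new: "new \<in> R" "new \<noteq> (l, r)"
    and u: "rstep C {new} r u" and r': "(rstep C R)\<^sup>*\<^sup>* u r'"
  shows "refines T R T (insert (l, r') (R - {(l, r)}))" (is "refines T R T ?R'")
  unfolding refines_def
proof (intro conjI allI impI)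
  have R: "oriented R"
    using assms(1) by (simp add: valid_state_def)
  note m = orientedD[OF R lr]
  note m' = simplified_rule_gtf[OF R lr new(1) u r']
  have R0: "oriented (R - {(l, r)})"
    using R by (rule oriented_subset) auto
  have "rstep C (R - {(l, r)}) r u"
    using u new by (auto elim!: rstep.cases intro!: rstep.intros)
  with rsteps_remove_rule[OF R r' m(1) m'(1,2)] have r_r': "(rstep C (R - {(l, r)}))\<^sup>*\<^sup>* r r'"
    by (metis converse_rtranclp_into_rtranclp)
  show "valid_state T ?R'"
    using assms(1) R0 m(1) m' by (auto simp: valid_state_def intro: oriented_insert)
  show sim: "simulated (T \<union> R) (T \<union> ?R')"
    unfolding simulated_def
  proof (clarify, goal_cases)
    case (1 A B Q)
    show ?case
    proof (cases "(A, B) = (l, r)")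
      case True
      have "conv Q (T \<union> ?R') r r' \<and> r' \<in> Q"
        using 1 True by (intro rsteps_imp_conv[OF R0 r_r']) auto
      moreover from this have "conv Q (T \<union> ?R') l r'"
        using 1 True by (intro r_into_rtranclp estep_base) auto
      ultimately show ?thesis
        using True by (auto intro: conv_sym rtranclp_trans)
    next
      case False
      then show ?thesis
        using 1 by (intro r_into_rtranclp estep_base) auto
    qed
  qed
  have "(r, r') \<in> ACCC C (T \<union> R)"
    using rsteps_imp_ACCC[OF r_r' m(2)] ACCC_mono[of "R - {(l, r)}" "T \<union> R"] by blast
  then have "(l, r') \<in> ACCC C (T \<union> R)"
    using lr by (blast intro: ACCC.base ACCC.trans)
  then show "T \<union> ?R' \<subseteq> ACCC C (T \<union> R)"
    by (auto intro: ACCC.base)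
  show "reducible C ?R' M" if "reducible C R M" for M
    using that by (auto simp: reducible_iff)
  show "connected_pairs (T \<union> ?R') ?R'" if conn: "connected_pairs (T \<union> R) R"
  proof -
    have old: "connected_pairs (T \<union> ?R') (R - {(l, r)})"
      by (rule connected_pairs_simulated[OF conn sim _ R valid_state_sub[OF assms(1)]]) auto
    \<comment> \<open>The overlap \<open>L\<close> depends on left-hand sides only, so it stays the
      same. One component of the pair moves from \<open>L - l + r\<close> to
      \<open>L - l + r'\<close>, by rewriting that remains below \<open>L\<close>.\<close>
    have changed: "conv (below (fst (l, r') \<union># fst q)) (T \<union> ?R')
        (fst (critical_pair (l, r') q)) (snd (critical_pair (l, r') q))"
      if q: "q \<in> R - {(l, r)}" for q
    proof -
      obtain B1 B2 where q_eq: "q = (B1, B2)"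
        by (cases q)
      define L where "L = l \<union># B1"
      have B: "B1 \<in> monomials C"
        using q q_eq orientedD[OF R] by auto
      then have L: "L \<in> monomials C"
        using m by (simp add: L_def)
      have "conv (below L) (T \<union> R) (L - l + r) (L - B1 + B2)"
        using conn lr q unfolding connected_pairs_def q_eq L_def
        by (metis DiffD1 DiffD2 critical_pair_sup fst_conv singletonI snd_conv)
      then have old: "conv (below L) (T \<union> ?R') (L - l + r) (L - B1 + B2)"
        by (rule simulated_conv[OF sim valid_state_sub[OF assms(1)] downset_below[OF L]])
      have "l \<subseteq># L"
        by (simp add: L_def)
      then have below: "L - l + r \<in> below L"
        unfolding below_def using rule_step_gtf[OF m L] monomials_diff_add[OF L m(2)] by blast
      have "set_mset (L - l) \<subseteq> C"
        using L by (auto simp: monomials_def dest: in_diffD)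
      then have steps: "(rstep C (R - {(l, r)}))\<^sup>*\<^sup>* (L - l + r) (L - l + r')"
        using rsteps_context[OF r_r', of "L - l"] by (simp only: add.commute)
      have "conv (below L) (T \<union> ?R') (L - l + r) (L - l + r')"
        using rsteps_imp_conv[OF R0 steps downset_below[OF L] below, of "T \<union> ?R'"] by blast
      with old have "conv (below L) (T \<union> ?R') (L - l + r') (L - B1 + B2)"
        using conv_sym rtranclp_trans by metis
      then show ?thesis
        by (simp only: q_eq critical_pair_sup L_def fst_conv snd_conv)
    qed
    show ?thesis
      unfolding connected_pairs_def
    proof (intro ballI impI)
      fix p q
      assume "p \<in> ?R'" "q \<in> ?R'" "p \<noteq> q"
      then consider "p \<in> R - {(l, r)}" "q \<in> R - {(l, r)}" | "p = (l, r')" "q \<in> R - {(l, r)}"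
        | "q = (l, r')" "p \<in> R - {(l, r)}"
        by blast
      then show "conv (below (fst p \<union># fst q)) (T \<union> ?R')
          (fst (critical_pair p q)) (snd (critical_pair p q))"
      proof cases
        case 1
        then show ?thesis
          using old \<open>p \<noteq> q\<close> by (simp add: connected_pairs_def)
      next
        case 2
        then show ?thesis
          using changed by blast
      next
        case 3
        then show ?thesis
          using changed connected_pair_swap by blast
      qed
    qed
  qed
qed

lemma critical_pair_ACCC:
  assumes "oriented R" and "p \<in> R" and "q \<in> R"
  shows "critical_pair p q \<in> ACCC C R"
proof -
  obtain A1 A2 B1 B2 where pq: "p = (A1, A2)" "q = (B1, B2)"
    by (cases p; cases q) auto
  define L where "L = A1 \<union># B1"
  have "L \<in> monomials C" "A1 \<subseteq># L" "B1 \<subseteq># L"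
    using orientedD[OF assms(1)] assms(2,3) pq by (auto simp: L_def)
  then have "rstep C R L (L - A1 + A2)" "rstep C R L (L - B1 + B2)"
    using assms(2,3) pq by (blast intro: rstep.intros)+
  then have "(L - A1 + A2, L - B1 + B2) \<in> ACCC C R"
    by (blast intro: rstep_imp_ACCC ACCC.sym ACCC.trans)
  then show ?thesis
    by (simp only: pq critical_pair_sup L_def)
qed

lemma refines_discard:
  assumes "valid_state T R" and "(l, r) \<in> T"
    and "(rstep C R)\<^sup>*\<^sup>* l u" and "(rstep C R)\<^sup>*\<^sup>* r u"
  shows "refines T R (T - {(l, r)}) R"
  unfolding refines_def
proof (intro conjI allI impI)
  have R: "oriented R"
    using assms(1) by (simp add: valid_state_def)
  show "valid_state (T - {(l, r)}) R"
    using assms(1) by (auto simp: valid_state_def)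
  show sim: "simulated (T \<union> R) (T - {(l, r)} \<union> R)"
    unfolding simulated_def
  proof (clarify, goal_cases)
    case (1 A B Q)
    show ?case
    proof (cases "(A, B) = (l, r)")
      case True
      have "conv Q (T - {(l, r)} \<union> R) l u" "conv Q (T - {(l, r)} \<union> R) r u"
        using 1 True rsteps_imp_conv[OF R assms(3)] rsteps_imp_conv[OF R assms(4)] by auto
      then show ?thesis
        using True by (auto intro: conv_sym rtranclp_trans)
    next
      case False
      then show ?thesis
        using 1 by (intro r_into_rtranclp estep_base) auto
    qed
  qed
  show "T - {(l, r)} \<union> R \<subseteq> ACCC C (T \<union> R)"
    by (auto intro: ACCC.base)
  show "connected_pairs (T - {(l, r)} \<union> R) R" if "connected_pairs (T \<union> R) R"
    by (rule connected_pairs_simulated[OF that sim _ R valid_state_sub[OF assms(1)]]) auto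
qed

text \<open>The equation \<open>l = r\<close> becomes the chain through \<open>l'\<close> and
  \<open>r'\<close>, which stays in every down-set containing \<open>l\<close> and \<open>r\<close>.
  New critical pairs are connected trivially, being pending equations themselves.\<close>

lemma refines_add:
  assumes "valid_state T R" and lr: "(l, r) \<in> T"
    and l': "(rstep C R)\<^sup>*\<^sup>* l l'" and r': "(rstep C R)\<^sup>*\<^sup>* r r'"
    and ab: "(a, b) = (l', r') \<or> (a, b) = (r', l')" "gtf a b"
  shows "refines T R (T - {(l, r)} \<union> critical_pair (a, b) ` R) (insert (a, b) R)"
    (is "refines T R ?T' ?R'")
  unfolding refines_def
proof (intro conjI allI impI)
  have R: "oriented R"
    using assms(1) by (simp add: valid_state_def)
  have m: "l \<in> monomials C" "r \<in> monomials C"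
    using assms(1) lr by (auto simp: valid_state_def)
  then have m': "l' \<in> monomials C" "r' \<in> monomials C"
    using rsteps_gtf[OF R] l' r' by blast+
  have R': "oriented ?R'"
    using R ab m' by (intro oriented_insert) auto
  have cp_below: "fst (critical_pair (a, b) q) \<in> below (a \<union># fst q)"
    "snd (critical_pair (a, b) q) \<in> below (a \<union># fst q)" if "q \<in> R" for q
    using critical_pair_below[of "(a, b)" q] oriented_subset[OF R', of "{(a, b), q}"] that by auto
  have "critical_pair (a, b) ` R \<subseteq> monomials C \<times> monomials C"
    using cp_below unfolding below_def
    by (intro image_subsetI) (simp add: mem_Times_iff del: critical_pair.simps)
  then show "valid_state ?T' ?R'"
    using assms(1) R' by (auto simp: valid_state_def)
  show sim: "simulated (T \<union> R) (?T' \<union> ?R')"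
    unfolding simulated_def
  proof (clarify, goal_cases)
    case (1 A B Q)
    show ?case
    proof (cases "(A, B) = (l, r)")
      case True
      have "conv Q (?T' \<union> ?R') l l' \<and> l' \<in> Q"
        using 1 True by (intro rsteps_imp_conv[OF R l']) auto
      moreover have "conv Q (?T' \<union> ?R') r r' \<and> r' \<in> Q"
        using 1 True by (intro rsteps_imp_conv[OF R r']) auto
      ultimately have conv: "conv Q (?T' \<union> ?R') l l'" "conv Q (?T' \<union> ?R') r r'"
        and "l' \<in> Q" "r' \<in> Q"
        by auto
      then have "conv Q (?T' \<union> ?R') a b"
        using ab by (intro r_into_rtranclp estep_base) auto
      then have "conv Q (?T' \<union> ?R') l' r'"
        using ab(1) by (auto intro: conv_sym)
      with conv show ?thesis
        using True by (auto intro: conv_sym rtranclp_trans)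
    next
      case False
      then show ?thesis
        using 1 by (intro r_into_rtranclp estep_base) auto
    qed
  qed
  have "(l, l') \<in> ACCC C (T \<union> R)" "(r, r') \<in> ACCC C (T \<union> R)"
    using rsteps_imp_ACCC[OF l' m(1)] rsteps_imp_ACCC[OF r' m(2)] ACCC_mono[of R "T \<union> R"] by blast+
  then have "(l', r') \<in> ACCC C (T \<union> R)"
    using lr by (blast intro: ACCC.base ACCC.sym ACCC.trans)
  then have "?R' \<subseteq> ACCC C (T \<union> R)"
    using ab(1) by (auto intro: ACCC.base ACCC.sym)
  moreover from this have "critical_pair (a, b) ` R \<subseteq> ACCC C (T \<union> R)"
    using critical_pair_ACCC[OF R', of "(a, b)"] ACCC_subset by blast
  ultimately show "?T' \<union> ?R' \<subseteq> ACCC C (T \<union> R)"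
    by (auto intro: ACCC.base simp del: critical_pair.simps)
  show "reducible C ?R' M" if "reducible C R M" for M
    using that by (auto simp: reducible_iff)
  show "connected_pairs (?T' \<union> ?R') ?R'" if "connected_pairs (T \<union> R) R"
  proof -
    have old: "connected_pairs (?T' \<union> ?R') R"
      by (rule connected_pairs_simulated[OF that sim _ R valid_state_sub[OF assms(1)]]) auto
    \<comment> \<open>A single step by the pending critical pair suffices, since both of its sides
      are below the overlap.\<close>
    have added: "conv (below (fst (a, b) \<union># fst q)) (?T' \<union> ?R')
        (fst (critical_pair (a, b) q)) (snd (critical_pair (a, b) q))" if "q \<in> R" for q
      using cp_below[OF that] that by (intro r_into_rtranclp estep_base)
        (auto simp del: critical_pair.simps)
    show ?thesis
      unfolding connected_pairs_def
    proof (intro ballI impI)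
      fix p q
      assume "p \<in> ?R'" "q \<in> ?R'" "p \<noteq> q"
      then consider "p \<in> R" "q \<in> R" | "p = (a, b)" "q \<in> R" | "q = (a, b)" "p \<in> R"
        by blast
      then show "conv (below (fst p \<union># fst q)) (?T' \<union> ?R')
          (fst (critical_pair p q)) (snd (critical_pair p q))"
      proof cases
        case 1
        then show ?thesis
          using old \<open>p \<noteq> q\<close> by (simp add: connected_pairs_def)
      next
        case 2
        then show ?thesis
          using added by blast
      next
        case 3
        then show ?thesis
          using added connected_pair_swap by blast
      qed
    qed
  qed
qed

section \<open>Interreduction and one iteration of the main loop\<close>

text \<open>As \<open>new\<close> is never among the rules \<open>P\<close> still to be treated, it
  stays in \<open>R\<close> throughout and differs from the rule being changed.\<close>

lemma interreduce_refines:
  assumes "interreduce C new P T R T' R'" and "valid_state T R"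
    and "P \<subseteq> R" and "new \<in> R" and "new \<notin> P"
  shows "refines T R T' R'"
  using assms
proof induction
  case (finished T R)
  then show ?case
    by (simp add: refines_refl)
next
  case (move l r P T R T' R')
  have step: "refines T R (insert (l, r) T) (R - {(l, r)})"
    using move by (intro refines_move[where new = new]) auto
  have "refines (insert (l, r) T) (R - {(l, r)}) T' R'"
    using move.hyps move.prems refines_valid[OF step] by (intro move.IH) auto
  with step show ?case
    by (rule refines_trans)
next
  case (simplify l r P u R r' T T' R')
  have step: "refines T R T (insert (l, r') (R - {(l, r)}))"
    using simplify by (intro refines_simplify[where new = new and u = u])
      (auto simp: normal_form_of_def)
  have "refines T (insert (l, r') (R - {(l, r)})) T' R'"
    using simplify.hyps simplify.prems refines_valid[OF step] by (intro simplify.IH) auto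
  with step show ?case
    by (rule refines_trans)
next
  case (keep l r P T R T' R')
  then show ?case
    by auto
qed

text \<open>Interreduction never gets stuck: the cases are exhaustive, and every change keeps the
  rules oriented, so the normal forms asked for exist by termination of rewriting.\<close>

lemma interreduce_exists:
  assumes "finite P" and "oriented R" and "P \<subseteq> R" and "new \<in> R" and "new \<notin> P"
  shows "\<exists>T' R'. interreduce C new P T R T' R'"
  using assms
proof (induction P arbitrary: T R rule: finite_psubset_induct)
  case (psubset P)
  show ?case
  proof (cases "P = {}")
    case True
    then show ?thesis
      by (blast intro: interreduce.finished)
  next
    case False
    then obtain l r where lr: "(l, r) \<in> P"
      by auto
    then have less: "P - {(l, r)} \<subset> P" and lrR: "(l, r) \<in> R"
      using psubset.prems by auto
    have R0: "oriented (R - {(l, r)})"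
      using psubset.prems(1) by (rule oriented_subset) auto
    note IH = psubset.IH[OF less]
    consider "reducible C {new} l" | "\<not> reducible C {new} l" "\<not> reducible C {new} r"
      | u where "\<not> reducible C {new} l" "rstep C {new} r u"
      by (auto simp: reducible_def)
    then show ?thesis
    proof cases
      case 1
      have "\<exists>T' R'. interreduce C new (P - {(l, r)}) (insert (l, r) T) (R - {(l, r)}) T' R'"
        using psubset.prems R0 lr by (intro IH) auto
      with 1 lr show ?thesis
        by (blast intro: interreduce.move)
    next
      case 2
      have "\<exists>T' R'. interreduce C new (P - {(l, r)}) T R T' R'"
        using psubset.prems lr by (intro IH) auto
      with 2 lr show ?thesis
        by (blast intro: interreduce.keep)
    next
      case (3 u)
      obtain r' where r': "normal_form_of C R u r'"
        using normal_form_exists[OF psubset.prems(1)] by blast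
      then have "(rstep C R)\<^sup>*\<^sup>* u r'"
        by (simp add: normal_form_of_def)
      note m = simplified_rule_gtf[OF psubset.prems(1) lrR psubset.prems(3) 3(2) this]
      have "\<exists>T' R'. interreduce C new (P - {(l, r)}) T (insert (l, r') (R - {(l, r)})) T' R'"
        using psubset.prems R0 lr m orientedD[OF psubset.prems(1) lrR]
        by (intro IH oriented_insert) auto
      with 3 lr r' show ?thesis
        by (blast intro: interreduce.simplify)
    qed
  qed
qed

text \<open>Either orientation has a normal form with respect to \<open>R\<close> as left-hand side,
  so the new rule reduces a monomial that \<open>R\<close> does not.\<close>

lemma add_rule_new:
  assumes "valid_state T R" and "(l, r) \<in> T"
    and "normal_form_of C R l l'" and "normal_form_of C R r r'" and "l' \<noteq> r'"
    and new: "new = (if gtf l' r' then (l', r') else (r', l'))"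
  shows "refines T R (T - {(l, r)} \<union> critical_pair new ` R) (insert new R)"
    and "fst new \<in> monomials C" and "\<not> reducible C R (fst new)" and "new \<notin> R"
proof -
  have R: "oriented R"
    using assms(1) by (simp add: valid_state_def)
  have nf: "(rstep C R)\<^sup>*\<^sup>* l l'" "\<not> reducible C R l'"
    "(rstep C R)\<^sup>*\<^sup>* r r'" "\<not> reducible C R r'"
    using assms by (auto simp: normal_form_of_def)
  have "l \<in> monomials C" "r \<in> monomials C"
    using assms(1,2) by (auto simp: valid_state_def)
  then have m: "l' \<in> monomials C" "r' \<in> monomials C"
    using rsteps_gtf[OF R] nf by blast+
  obtain a b where ab: "new = (a, b)"
    by (cases new)
  have or: "(a, b) = (l', r') \<or> (a, b) = (r', l')" "gtf a b"
    using new ab gtf_total[OF m assms(5)] by (auto split: if_splits)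
  show "refines T R (T - {(l, r)} \<union> critical_pair new ` R) (insert new R)"
    unfolding ab by (rule refines_add[OF assms(1,2) nf(1,3) or])
  show a: "fst new \<in> monomials C" "\<not> reducible C R (fst new)"
    using or m nf ab by auto
  then show "new \<notin> R"
    by (auto simp: reducible_iff)
qed

lemma completion_step_refines:
  assumes "completion_step C gtf (T, R) (T', R')" and "valid_state T R"
  shows "refines T R T' R'"
    and "{M. reducible C R M} \<subset> {M. reducible C R' M} \<or> R' = R \<and> card T' < card T"
proof -
  have "refines T R T' R' \<and>
    ({M. reducible C R M} \<subset> {M. reducible C R' M} \<or> R' = R \<and> card T' < card T)"
    using assms(1)
  proof cases
    case (discard l r l' r')
    have "refines T R T' R'"
      using discard refines_discard[OF assms(2)] by (auto simp: normal_form_of_def)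
    moreover have "card T' < card T"
      unfolding discard(1) using discard(3) assms(2)
      by (intro card_Diff1_less) (auto simp: valid_state_def)
    ultimately show ?thesis
      using discard by simp
  next
    case (add_rule l r l' r' new)
    note new = add_rule_new[OF assms(2) add_rule(1-5)]
    have "refines (T - {(l, r)} \<union> critical_pair new ` R) (insert new R) T' R'"
      using add_rule(6) refines_valid[OF new(1)] new(4) by (intro interreduce_refines) auto
    with new(1) have ref: "refines T R T' R'"
      and red: "\<And>M. reducible C (insert new R) M \<Longrightarrow> reducible C R' M"
      by (auto intro: refines_trans simp: refines_def[of _ "insert new R"])
    \<comment> \<open>The witness for strict growth: irreducible before the step, and still
      reducible after interreduction even if other rules have disappeared.\<close>
    have "reducible C R' (fst new)"
      using new(2) by (intro red) (cases new, auto simp: reducible_iff)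
    with ref new(3) show ?thesis
      by (auto simp: refines_def)
  qed
  then show "refines T R T' R'"
    and "{M. reducible C R M} \<subset> {M. reducible C R' M} \<or> R' = R \<and> card T' < card T"
    by auto
qed

lemma completion_steps_refine:
  assumes "(completion_step C gtf)\<^sup>*\<^sup>* (T, R) (T', R')" and "valid_state T R"
  shows "refines T R T' R'"
  using assms(1)
proof (induction rule: rtranclp_induct2)
  case refl
  show ?case
    using assms(2) by (rule refines_refl)
next
  case (step T1 R1 T2 R2)
  then show ?case
    using completion_step_refines(1) refines_valid refines_trans by blast
qed

lemma completion_step_exists:
  assumes "valid_state T R" and "T \<noteq> {}"
  shows "\<exists>T' R'. completion_step C gtf (T, R) (T', R')"
proof -
  have R: "oriented R" "finite R"
    using assms(1) by (simp_all add: valid_state_def)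
  obtain l r where lr: "(l, r) \<in> T"
    using assms(2) by auto
  obtain l' r' where nf: "normal_form_of C R l l'" "normal_form_of C R r r'"
    using normal_form_exists[OF R(1)] by blast
  show ?thesis
  proof (cases "l' = r'")
    case True
    with lr nf show ?thesis
      by (blast intro: completion_step.discard)
  next
    case False
    define new where "new = (if gtf l' r' then (l', r') else (r', l'))"
    note add = add_rule_new[OF assms(1) lr nf False new_def]
    have "oriented (insert new R)"
      using refines_valid[OF add(1)] by (simp add: valid_state_def)
    then obtain T' R' where
      "interreduce C new R (T - {(l, r)} \<union> critical_pair new ` R) (insert new R) T' R'"
      using interreduce_exists[OF R(2), of "insert new R" new] add(4) by blast
    with lr nf False new_def show ?thesis
      by (blast intro: completion_step.add_rule)
  qed
qed

section \<open>Existence of a finished run, and deciding equality\<close>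

lemma reducible_ideal: "{M. reducible C R M} \<in> mset_ideals C"
  by (auto simp: mset_ideals_def reducible_iff monomials_def intro: subset_mset.order_trans)

text \<open>Supplies an output by following available steps down a lexicographic order.
  \<open>T\<close> may grow through critical pairs, but only when the ideal of reducible monomials
  grows too.\<close>

lemma completion_terminates:
  assumes "finite C" and "valid_state T R"
  shows "\<exists>R'. (completion_step C gtf)\<^sup>*\<^sup>* (T, R) ({}, R')"
proof -
  define W where "W = inv_image
    ({(J, I). I \<in> mset_ideals C \<and> J \<in> mset_ideals C \<and> I \<subset> J} <*lex*> less_than)
    (\<lambda>(T :: 'c eqs, R). ({M. reducible C R M}, card T))"
  have "wf W"
    unfolding W_def by (intro wf_inv_image wf_lex_prod wf_ascending_ideals assms(1) wf_less_than)
  then have "valid_state (fst S) (snd S) \<Longrightarrow> \<exists>R'. (completion_step C gtf)\<^sup>*\<^sup>* S ({}, R')" for S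
  proof (induction S rule: wf_induct_rule)
    case (less S)
    obtain T R where S: "S = (T, R)"
      by (cases S)
    show ?case
    proof (cases "T = {}")
      case True
      then show ?thesis
        using S by blast
    next
      case False
      have valid: "valid_state T R"
        using less.prems S by simp
      then obtain T' R' where step: "completion_step C gtf (T, R) (T', R')"
        using completion_step_exists False by blast
      have "((T', R'), S) \<in> W"
        using completion_step_refines(2)[OF step valid] reducible_ideal by (auto simp: S W_def)
      moreover have "valid_state T' R'"
        using completion_step_refines(1)[OF step valid] by (rule refines_valid)
      ultimately show ?thesis
        using less.IH[of "(T', R')"] step S by (auto intro: converse_rtranclp_into_rtranclp)
    qed
  qed
  from this[of "(T, R)"] assms(2) show ?thesis
    by simp
qed

text \<open>Church-Rosser joins equal monomials, and termination extends the join to a common normal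
  form; conversely, rewriting stays inside \<open>ACCC\<close>.\<close>

lemma confluent_imp_decides:
  assumes R: "oriented R" and "confluentp (rstep C R)" and "s \<in> monomials C" "t \<in> monomials C"
  shows "(s, t) \<in> ACCC C R \<longleftrightarrow> (\<exists>u. normal_form_of C R s u \<and> normal_form_of C R t u)"
proof
  have sub: "R \<subseteq> monomials C \<times> monomials C"
    using R by (simp add: oriented_def)
  assume st: "(s, t) \<in> ACCC C R"
  have "joinable C R s t"
    by (rule conv_imp_joinable[OF ACCC_imp_conv[OF sub st] _ sub subset_refl])
      (unfold joinable_def, rule confluentpD[OF assms(2)])
  then obtain v where "(rstep C R)\<^sup>*\<^sup>* s v" "(rstep C R)\<^sup>*\<^sup>* t v"
    by (auto simp: joinable_def)
  moreover obtain u where "normal_form_of C R v u"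
    using normal_form_exists[OF R] by blast
  ultimately show "\<exists>u. normal_form_of C R s u \<and> normal_form_of C R t u"
    by (auto simp: normal_form_of_def intro: rtranclp_trans)
next
  assume "\<exists>u. normal_form_of C R s u \<and> normal_form_of C R t u"
  then show "(s, t) \<in> ACCC C R"
    using assms(3,4) by (auto simp: normal_form_of_def
        intro: rsteps_imp_ACCC ACCC.sym ACCC.trans)
qed

end

section \<open>The constant rules\<close>

lemma equivclp_closed:
  assumes "equivclp (\<lambda>x y. (x, y) \<in> SC) c d" and "SC \<subseteq> C \<times> C" and "c \<in> C"
  shows "d \<in> C"
  using assms by (induction rule: equivclp_induct) auto

lemma const_rule_exists:
  assumes "finite C" and SC: "SC \<subseteq> C \<times> C" and "strict_total_order_on C gt" and "c \<in> C"
  shows "\<exists>d. equivclp (\<lambda>x y. (x, y) \<in> SC) c d \<and> (c = d \<or> ({#c#}, {#d#}) \<in> const_rules C gt SC) \<and>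
    (\<forall>e. equivclp (\<lambda>x y. (x, y) \<in> SC) c e \<and> e \<noteq> d \<longrightarrow> gt e d)"
proof -
  let ?K = "{d. equivclp (\<lambda>x y. (x, y) \<in> SC) c d}"
  have sub: "?K \<subseteq> C"
    using equivclp_closed[OF _ SC assms(4)] by blast
  have "\<exists>d\<in>?K. \<forall>e\<in>?K. e \<noteq> d \<longrightarrow> gt e d"
  \<comment> \<open>Since \<open>gt\<close> points downwards, the greatest element for the relation
    \<open>gt\<close> is the least constant of the class.\<close>
  proof (rule Finite_Set.bex_greatest_element)
    show "finite ?K"
      using sub assms(1) by (rule finite_subset)
    have "c \<in> ?K"
      by simp
    then show "?K \<noteq> {}"
      by blast
    show "transp_on ?K gt" "totalp_on ?K gt"
      using assms(3) sub by (auto simp: strict_total_order_on_def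
          intro: transp_on_subset totalp_on_subset)
  qed
  then obtain d where "equivclp (\<lambda>x y. (x, y) \<in> SC) c d"
    "\<forall>e. equivclp (\<lambda>x y. (x, y) \<in> SC) c e \<and> e \<noteq> d \<longrightarrow> gt e d"
    by auto
  with assms(4) show ?thesis
    unfolding const_rules_def by blast
qed

lemma least_unique:
  assumes "SC \<subseteq> C \<times> C" and "strict_total_order_on C gt" and "c \<in> C"
    and "equivclp (\<lambda>x y. (x, y) \<in> SC) c d" and "equivclp (\<lambda>x y. (x, y) \<in> SC) c d'"
    and "\<forall>e. equivclp (\<lambda>x y. (x, y) \<in> SC) c e \<and> e \<noteq> d \<longrightarrow> gt e d"
    and "\<forall>e. equivclp (\<lambda>x y. (x, y) \<in> SC) c e \<and> e \<noteq> d' \<longrightarrow> gt e d'"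
  shows "d = d'"
proof (rule ccontr)
  assume "d \<noteq> d'"
  then have "gt d' d" "gt d d'"
    using assms by auto
  moreover have "d \<in> C" "d' \<in> C"
    using equivclp_closed[OF _ assms(1,3)] assms(4,5) by blast+
  ultimately show False
    using assms(2) by (auto simp: strict_total_order_on_def dest: transp_onD irreflp_onD)
qed

text \<open>Constants related by \<open>SC\<close> share one class and thus one least
  representative, which each reaches by at most one rule; conversely, each rule follows from a path
  of equations within a class.\<close>

lemma const_rules_ACCC:
  assumes "finite C" and SC: "SC \<subseteq> C \<times> C" and gt: "strict_total_order_on C gt"
  shows "ACCC C (Sf \<union> const_rules C gt SC) = ACCC C (const_eqs SC \<union> Sf)"
proof (intro equalityI ACCC_subset subrelI)
  fix s t
  assume "(s, t) \<in> Sf \<union> const_rules C gt SC"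
  moreover have "({#c#}, {#d#}) \<in> ACCC C (const_eqs SC \<union> Sf)"
    if "equivclp (\<lambda>x y. (x, y) \<in> SC) c d" "c \<in> C" for c d
    using that
  proof (induction rule: equivclp_induct)
    case base
    then show ?case
      by (auto intro: ACCC.refl simp: monomials_def)
  next
    case (step y z)
    then have "({#y#}, {#z#}) \<in> ACCC C (const_eqs SC \<union> Sf)"
      by (auto simp: const_eqs_def intro: ACCC.base ACCC.sym)
    with step show ?case
      by (blast intro: ACCC.trans)
  qed
  ultimately show "(s, t) \<in> ACCC C (const_eqs SC \<union> Sf)"
    by (auto simp: const_rules_def intro: ACCC.base)
next
  let ?E = "ACCC C (Sf \<union> const_rules C gt SC)"
  fix s t
  assume "(s, t) \<in> const_eqs SC \<union> Sf"
  moreover have "({#c#}, {#d#}) \<in> ?E" if cd: "(c, d) \<in> SC" for c d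
  proof -
    have C: "c \<in> C" "d \<in> C"
      using cd SC by auto
    obtain c' where c': "equivclp (\<lambda>x y. (x, y) \<in> SC) c c'"
      "c = c' \<or> ({#c#}, {#c'#}) \<in> const_rules C gt SC"
      "\<forall>e. equivclp (\<lambda>x y. (x, y) \<in> SC) c e \<and> e \<noteq> c' \<longrightarrow> gt e c'"
      using const_rule_exists[OF assms C(1)] by blast
    obtain d' where d': "equivclp (\<lambda>x y. (x, y) \<in> SC) d d'"
      "d = d' \<or> ({#d#}, {#d'#}) \<in> const_rules C gt SC"
      "\<forall>e. equivclp (\<lambda>x y. (x, y) \<in> SC) d e \<and> e \<noteq> d' \<longrightarrow> gt e d'"
      using const_rule_exists[OF assms C(2)] by blast
    have "equivclp (\<lambda>x y. (x, y) \<in> SC) c d"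
      using cd by auto
    then have "equivclp (\<lambda>x y. (x, y) \<in> SC) c e \<longleftrightarrow> equivclp (\<lambda>x y. (x, y) \<in> SC) d e" for e
      by (meson equivclp_sym equivclp_trans)
    then have "c' = d'"
      using least_unique[OF SC gt C(1) c'(1) _ c'(3), of d'] d'(1,3) by simp
    moreover have "({#c#}, {#c'#}) \<in> ?E" "({#d#}, {#d'#}) \<in> ?E"
      using c'(2) d'(2) C by (auto intro: ACCC.base ACCC.refl simp: monomials_def)
    ultimately show ?thesis
      by (blast intro: ACCC.sym ACCC.trans)
  qed
  ultimately show "(s, t) \<in> ?E"
    by (auto simp: const_eqs_def intro: ACCC.base)
qed

lemma (in monomial_order) const_rules_oriented:
  assumes "SC \<subseteq> C \<times> C" and "\<forall>c\<in>C. \<forall>d\<in>C. gt c d \<longrightarrow> gtf {#c#} {#d#}"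
  shows "oriented (const_rules C gt SC)"
  using assms(2) equivclp_closed[OF _ assms(1)]
  by (fastforce simp: oriented_def const_rules_def monomials_def)

text \<open>The base case of the invariant: critical pairs among the initial rules are not put into
  \<open>T\<close>, so they have to be connected by the rules themselves.\<close>

lemma (in monomial_order) const_rules_connected:
  assumes SC: "SC \<subseteq> C \<times> C" and gt: "strict_total_order_on C gt"
    and "\<forall>c\<in>C. \<forall>d\<in>C. gt c d \<longrightarrow> gtf {#c#} {#d#}" and E: "const_rules C gt SC \<subseteq> E"
  shows "connected_pairs E (const_rules C gt SC)" (is "connected_pairs E ?R")
  unfolding connected_pairs_def
proof (intro ballI impI)
  fix p q
  assume p: "p \<in> ?R" and q: "q \<in> ?R" and "p \<noteq> q"
  have R: "oriented ?R"
    using assms(1,3) by (rule const_rules_oriented)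
  obtain c c' where c: "p = ({#c#}, {#c'#})" "c \<in> C" "equivclp (\<lambda>x y. (x, y) \<in> SC) c c'"
    "\<forall>e. equivclp (\<lambda>x y. (x, y) \<in> SC) c e \<and> e \<noteq> c' \<longrightarrow> gt e c'"
    using p unfolding const_rules_def by blast
  obtain d d' where d: "q = ({#d#}, {#d'#})" "d \<in> C" "equivclp (\<lambda>x y. (x, y) \<in> SC) d d'"
    "\<forall>e. equivclp (\<lambda>x y. (x, y) \<in> SC) d e \<and> e \<noteq> d' \<longrightarrow> gt e d'"
    using q unfolding const_rules_def by blast
  \<comment> \<open>The least representative is unique, so distinct rules already differ on the
    left. Their left-hand sides are then disjoint, and applying the other rule joins the pair at
    \<open>{#c', d'#}\<close>.\<close>
  have "c \<noteq> d"
    using least_unique[OF SC gt c(2,3) _ c(4), of d'] c(1) d(1,3,4) \<open>p \<noteq> q\<close> by auto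
  then have L: "{#c#} \<union># {#d#} = {#c, d#}"
    by (simp add: union_mset_def)
  then have cp: "critical_pair p q = ({#d, c'#}, {#c, d'#})"
    unfolding c d critical_pair_sup by simp
  have C': "c' \<in> C" "d' \<in> C"
    using equivclp_closed[OF _ SC] c d by blast+
  have "rstep C ?R {#d, c'#} ({#d, c'#} - {#d#} + {#d'#})"
    using q d C' by (intro rstep.intros) (auto simp: monomials_def)
  moreover have "rstep C ?R {#c, d'#} ({#c, d'#} - {#c#} + {#c'#})"
    using p c C' by (intro rstep.intros) (auto simp: monomials_def)
  ultimately have steps: "(rstep C ?R)\<^sup>*\<^sup>* {#d, c'#} {#c', d'#}" "(rstep C ?R)\<^sup>*\<^sup>* {#c, d'#} {#c', d'#}"
    by (auto simp: add_mset_commute)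
  have "oriented {p, q}"
    using R by (rule oriented_subset) (use p q in auto)
  note b = critical_pair_below[OF this, unfolded cp fst_conv snd_conv]
  have "downset (below (fst p \<union># fst q))"
    using c d by (intro downset_below sup_monomials) (auto simp: monomials_def)
  then show "conv (below (fst p \<union># fst q)) E (fst (critical_pair p q)) (snd (critical_pair p q))"
    unfolding cp fst_conv snd_conv
    using rsteps_imp_conv[OF R steps(1) _ b(1) E] rsteps_imp_conv[OF R steps(2) _ b(2) E]
    by (blast intro: conv_sym rtranclp_trans)
qed

lemma const_rules_finite:
  assumes "finite C" and "SC \<subseteq> C \<times> C"
  shows "finite (const_rules C gt SC)"
proof (rule finite_subset)
  show "const_rules C gt SC \<subseteq> (\<lambda>(c, d). ({#c#}, {#d#})) ` (C \<times> C)"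
    using equivclp_closed[OF _ assms(2)] by (force simp: const_rules_def)
qed (use assms(1) in simp)

text \<open>Existence of an output is part of the claim, so the statement about all outputs is not
  vacuous.\<close>

theorem theorem3p5:
  fixes C :: "'c set"
    and SC :: "('c \<times> 'c) set"
    and Sf :: "('c monomial \<times> 'c monomial) set"
    and gt :: "'c \<Rightarrow> 'c \<Rightarrow> bool"
    and gtf :: "'c monomial \<Rightarrow> 'c monomial \<Rightarrow> bool"
  assumes "finite C"
    and "finite SC" and "SC \<subseteq> C \<times> C"
    and "finite Sf" and "Sf \<subseteq> monomials C \<times> monomials C"
    and "strict_total_order_on C gt"
    and "admissible_ordering C gt gtf"
  shows "(\<exists>R. single_AC_completion_output C gt gtf SC Sf R) \<and>
    (\<forall>R. single_AC_completion_output C gt gtf SC Sf R \<longrightarrow>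
      canonical C R \<and>
      (\<forall>s\<in>monomials C. \<forall>t\<in>monomials C.
        (s, t) \<in> ACCC C (const_eqs SC \<union> Sf) \<longleftrightarrow>
        (\<exists>u. normal_form_of C R s u \<and> normal_form_of C R t u)))"
proof -
  interpret monomial_order C gtf
  proof
    show "\<not> gtf s s" if "s \<in> monomials C" for s
      using assms(7) that unfolding admissible_ordering_def strict_total_order_on_def
      by (blast dest: irreflp_onD)
    show "gtf s u" if "s \<in> monomials C" "t \<in> monomials C" "u \<in> monomials C" "gtf s t" "gtf t u"
      for s t u
      using assms(7) that unfolding admissible_ordering_def strict_total_order_on_def
      by (blast dest: transp_onD)
    show "gtf s t \<or> gtf t s" if "s \<in> monomials C" "t \<in> monomials C" "s \<noteq> t" for s t
      using assms(7) that unfolding admissible_ordering_def strict_total_order_on_def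
      by (blast dest: totalp_onD)
  qed (use assms(7) in \<open>simp_all add: admissible_ordering_def\<close>)
  have gt: "\<forall>c\<in>C. \<forall>d\<in>C. gt c d \<longrightarrow> gtf {#c#} {#d#}"
    using assms(7) by (simp add: admissible_ordering_def)
  let ?R0 = "const_rules C gt SC"
  have valid: "valid_state Sf ?R0"
    using assms const_rules_finite const_rules_oriented[OF assms(3) gt] by (simp add: valid_state_def)
  have conn: "connected_pairs (Sf \<union> ?R0) ?R0"
    by (rule const_rules_connected[OF assms(3,6) gt]) simp
  have final: "oriented R" "confluentp (rstep C R)" "ACCC C R = ACCC C (const_eqs SC \<union> Sf)"
    if "(completion_step C gtf)\<^sup>*\<^sup>* (Sf, ?R0) ({}, R)" for R
  proof -
    have ref: "refines Sf ?R0 {} R"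
      using completion_steps_refine[OF that valid] .
    then show R: "oriented R"
      by (simp add: refines_def valid_state_def)
    have "connected_pairs R R"
      using ref conn by (simp add: refines_def)
    with R show "confluentp (rstep C R)"
      by (rule connected_pairs_confluent)
    show "ACCC C R = ACCC C (const_eqs SC \<union> Sf)"
      using refines_ACCC[OF valid ref] const_rules_ACCC[OF assms(1,3,6)] by simp
  qed
  show ?thesis
  proof (intro conjI allI impI)
    obtain R where run: "(completion_step C gtf)\<^sup>*\<^sup>* (Sf, ?R0) ({}, R)"
      using completion_terminates[OF assms(1) valid] by blast
    \<comment> \<open>The joinability demanded of an output is derived from confluence: the two
      components are equal in \<open>ACCC C R\<close>, hence have a common normal form.\<close>
    have "joinable C R (fst (critical_pair p q)) (snd (critical_pair p q))"
      if "p \<in> R" "q \<in> R" for p q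
    proof -
      have "critical_pair p q \<in> ACCC C R"
        using final(1)[OF run] that by (rule critical_pair_ACCC)
      moreover have "R \<subseteq> monomials C \<times> monomials C"
        using final(1)[OF run] by (simp add: oriented_def)
      ultimately have "(fst (critical_pair p q), snd (critical_pair p q)) \<in> ACCC C R"
        "fst (critical_pair p q) \<in> monomials C" "snd (critical_pair p q) \<in> monomials C"
        using ACCC_monomials[of R C "fst (critical_pair p q)" "snd (critical_pair p q)"]
        by (simp_all del: critical_pair.simps)
      then show ?thesis
        using confluent_imp_decides[OF final(1,2)[OF run]]
        unfolding joinable_def normal_form_of_def by blast
    qed
    with run show "\<exists>R. single_AC_completion_output C gt gtf SC Sf R"
      unfolding single_AC_completion_output_def by blast
  next
    fix R
    assume "single_AC_completion_output C gt gtf SC Sf R"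
    then have run: "(completion_step C gtf)\<^sup>*\<^sup>* (Sf, ?R0) ({}, R)"
      by (simp add: single_AC_completion_output_def)
    show "canonical C R"
      using final(1,2)[OF run] wfp_rstep by (simp add: canonical_def)
    show "\<forall>s\<in>monomials C. \<forall>t\<in>monomials C.
        (s, t) \<in> ACCC C (const_eqs SC \<union> Sf) \<longleftrightarrow>
        (\<exists>u. normal_form_of C R s u \<and> normal_form_of C R t u)"
      using confluent_imp_decides[OF final(1,2)[OF run]] final(3)[OF run] by simp
  qed
qed

end
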